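(* Let $\alpha:[0,+\infty)\to[1,+\infty)$ and $\beta:[0,+\infty)\to[0,1)$ be functions such that: (1) $\beta$ has the property $(MT)$; (2) $\alpha(t)\le 1+\gamma(1-\beta(t))$ for all $t\ge 0$, where $\gamma:(0,1]\to[0,+\infty)$ is a function with the following properties: (i) $\gamma$ is bounded and $\lim_{s\to 0}\gamma(s)=0$; (ii) the function $p(s)=s-(1-s)\gamma(s)$, $s<1$, is essentially positive. Then every $(\alpha,\beta)$-mapping $F$ of a complete metric space $(X,d)$ into itself is an $(\alpha,\beta)$-contraction and has a fixed point (i.e. a point $x_*\in X$ with $x_*\in F(x_* )$), whenever the distance function $d_F$ is stably positive.
   Context: A closed-valued mapping $F$ of a metric space $(X,d)$ into itself assigns to each $x\in X$ a nonempty closed subset $F(x)\subset X$. Its distance function is $d_F(x)=\mathrm{dist}(x,F(x))=\inf\{d(x,y): y\in F(x)\}$. Given $\alpha:[0,+\infty)\to[1,+\infty)$ and $\beta:[0,+\infty)\to[0,1)$, a closed-valued mapping $F$ of $(X,d)$ into itself is an $(\alpha,\beta)$-mapping if for each $x\in X$ there exists $y\in F(x)$ such that (A) $d(x,y)\le\alpha(d(x,y))\cdot d_F(x)$ and (B) $d_F(y)\le\beta(d(x,y))\cdot d(x,y)$. If, in addition, $\alpha(t)\beta(t)<1$ for all $t>0$, then $F$ is an $(\alpha,\beta)$-contraction. A function $k$ on $[0,\infty)$ has the property $(MT)$ if $\limsup_{s\to t+0}k(s)<1$ for every $t\ge 0$ (the limit superior as $s\to t$ with $s>t$). The function $p$ is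 essentially positive if $\inf\{p(s): a\le s<1\}>0$ for every $a\in(0,1)$. A nonnegative, not identically zero function $h:X\to[0,\infty)$ is stably positive if, for every $x\in X$, $h(x)>0$ implies that $\inf\{h(y): y\in O(x)\}>0$ for some neighborhood $O(x)$ of $x$. *)

theory Defs
  imports "HOL-Analysis.Analysis"
begin

definition closed_valued :: "('a::metric_space \<Rightarrow> 'a set) \<Rightarrow> bool" where
  "closed_valued F \<longleftrightarrow> (\<forall>x. F x \<noteq> {} \<and> closed (F x))"

definition distance_function :: "('a::metric_space \<Rightarrow> 'a set) \<Rightarrow> 'a \<Rightarrow> real" where
  "distance_function F x = infdist x (F x)"

text \<open>Functions on a subinterval of the real line are rendered as total functions
  \<^typ>\<open>real \<Rightarrow> real\<close>; only their values on the intended domain matter, and the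
  codomain restrictions are left to the users of these definitions.\<close>

definition alpha_beta_mapping ::
  "(real \<Rightarrow> real) \<Rightarrow> (real \<Rightarrow> real) \<Rightarrow> ('a::metric_space \<Rightarrow> 'a set) \<Rightarrow> bool" where
  "alpha_beta_mapping \<alpha> \<beta> F \<longleftrightarrow> closed_valued F \<and>
     (\<forall>x. \<exists>y\<in>F x.
        dist x y \<le> \<alpha> (dist x y) * distance_function F x \<and>
        distance_function F y \<le> \<beta> (dist x y) * dist x y)"

definition alpha_beta_contraction ::
  "(real \<Rightarrow> real) \<Rightarrow> (real \<Rightarrow> real) \<Rightarrow> ('a::metric_space \<Rightarrow> 'a set) \<Rightarrow> bool" where
  "alpha_beta_contraction \<alpha> \<beta> F \<longleftrightarrow>
     alpha_beta_mapping \<alpha> \<beta> F \<and> (\<forall>t>0. \<alpha> t * \<beta> t < 1)"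

text \<open>The limit superior and the infimum below are taken in the extended reals, so that
  they have their usual meaning also for unbounded functions.\<close>

definition property_MT :: "(real \<Rightarrow> real) \<Rightarrow> bool" where
  "property_MT k \<longleftrightarrow> (\<forall>t\<ge>0. Limsup (at_right t) (\<lambda>s. ereal (k s)) < 1)"

definition essentially_positive :: "(real \<Rightarrow> real) \<Rightarrow> bool" where
  "essentially_positive p \<longleftrightarrow> (\<forall>a\<in>{0<..<1}. (INF s\<in>{a..<1}. ereal (p s)) > 0)"

definition stably_positive :: "('a::topological_space \<Rightarrow> real) \<Rightarrow> bool" where
  "stably_positive h \<longleftrightarrow> (\<forall>x. h x \<ge> 0) \<and> (\<exists>x. h x \<noteq> 0) \<and>
     (\<forall>x. h x > 0 \<longrightarrow> (\<exists>U. open U \<and> x \<in> U \<and> (INF y\<in>U. h y) > 0))"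

end

theory Submission
  imports Defs
begin

text \<open>
  Put \<open>s = 1 - \<beta> t\<close>. The bound on \<open>\<alpha>\<close> gives \<open>\<alpha> t * \<beta> t \<le> (1 + \<gamma> s) * (1 - s) = 1 - p s\<close>,
  so essential positivity of \<open>p\<close> says that \<open>\<alpha> t * \<beta> t\<close> stays away from \<open>1\<close> as long as
  \<open>\<beta> t\<close> does (lemma \<open>product_bounded_away_from_one\<close>). In particular the product is always
  below \<open>1\<close>, and the mapping is a contraction.

  For the fixed point, iterate a selection of \<open>F\<close> that realises (A) and (B), and let
  \<open>d n\<close> be the step lengths and \<open>f n\<close> the values of the distance function along the orbit.
  If some step is \<open>0\<close>, a fixed point has been reached. Otherwise (A) and (B) give
  \<open>f (Suc n) \<le> \<alpha> (d n) * \<beta> (d n) * f n\<close>, so \<open>f\<close> decreases strictly to a limit \<open>L\<close>.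
  Suppose \<open>L > 0\<close>. Then the ratios of \<open>f\<close> tend to \<open>1\<close>, which forces \<open>\<beta> (d n)\<close> to tend to
  \<open>1\<close>; hence \<open>\<gamma> (1 - \<beta> (d n))\<close> tends to \<open>0\<close>, the factor in (A) tends to \<open>1\<close>, and \<open>d n\<close>
  tends to \<open>L\<close> as well, from the right. The property (MT) at \<open>L\<close> forbids this
  (lemma \<open>gap_tendsto_zero\<close>). Thus \<open>L = 0\<close>. Since \<open>\<gamma>\<close> is bounded, the steps tend to \<open>0\<close>
  too, and now (MT) at \<open>0\<close> yields a uniform contraction factor from some point on, so the
  steps are summable (lemma \<open>steps_summable\<close>) and the orbit converges. The distance
  function tends to \<open>0\<close> along the orbit, so stable positivity makes it vanish at the
  limit, which therefore is a fixed point because the values of \<open>F\<close> are closed.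
\<close>

section \<open>Quantitative forms of the hypotheses\<close>

lemma property_MT_bound:
  assumes "property_MT k" "t \<ge> 0"
  obtains b where "b < 1" "eventually (\<lambda>s. k s < b) (at_right t)"
proof -
  have "Limsup (at_right t) (\<lambda>s. ereal (k s)) < 1"
    using assms unfolding property_MT_def by blast
  then obtain b where b: "Limsup (at_right t) (\<lambda>s. ereal (k s)) < ereal b" "ereal b < 1"
    using ereal_dense2 by blast
  show thesis
  proof (rule that)
    show "b < 1" using b(2) by simp
    show "eventually (\<lambda>s. k s < b) (at_right t)"
      using Limsup_lessD[OF b(1)] by simp
  qed
qed

lemma essentially_positive_bound:
  assumes "essentially_positive p" "0 < a" "a < 1"
  obtains c where "c > 0" "\<And>s. a \<le> s \<Longrightarrow> s < 1 \<Longrightarrow> c \<le> p s"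
proof -
  have "0 < (INF s\<in>{a..<1}. ereal (p s))"
    using assms unfolding essentially_positive_def by auto
  then obtain c where c: "0 < ereal c" "ereal c < (INF s\<in>{a..<1}. ereal (p s))"
    using ereal_dense2 by blast
  have "c \<le> p s" if "a \<le> s" "s < 1" for s
  proof -
    have "(INF s\<in>{a..<1}. ereal (p s)) \<le> ereal (p s)"
      using that by (intro INF_lower) auto
    with c(2) show ?thesis by (metis ereal_less_eq(3) less_imp_le order_trans)
  qed
  with c(1) that show thesis by auto
qed

lemma product_bounded_away_from_one:
  fixes \<alpha> \<beta> \<gamma> :: "real \<Rightarrow> real"
  assumes beta_range: "\<And>t. t \<ge> 0 \<Longrightarrow> 0 \<le> \<beta> t \<and> \<beta> t < 1"
    and alpha_le: "\<And>t. t \<ge> 0 \<Longrightarrow> \<alpha> t \<le> 1 + \<gamma> (1 - \<beta> t)"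
    and p_ess_pos: "essentially_positive (\<lambda>s. s - (1 - s) * \<gamma> s)"
    and b: "b < 1"
  obtains q where "q < 1" "\<And>t. t \<ge> 0 \<Longrightarrow> \<beta> t \<le> b \<Longrightarrow> \<alpha> t * \<beta> t \<le> q"
proof -
  \<comment> \<open>The bound \<open>1/2\<close> keeps \<open>a\<close> below \<open>1\<close> when \<open>b \<le> 0\<close>.\<close>
  define a where "a = min (1 - b) (1/2)"
  have a: "0 < a" "a < 1" using b by (auto simp: a_def)
  obtain c where c: "c > 0" "\<And>s. a \<le> s \<Longrightarrow> s < 1 \<Longrightarrow> c \<le> s - (1 - s) * \<gamma> s"
    using essentially_positive_bound[OF p_ess_pos a] by blast
  define q where "q = max 0 (1 - c)"
  show thesis
  proof (rule that)
    show "q < 1" using c(1) by (auto simp: q_def)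
    fix t :: real assume t: "t \<ge> 0" "\<beta> t \<le> b"
    show "\<alpha> t * \<beta> t \<le> q"
    \<comment> \<open>For \<open>\<beta> t = 0\<close> the argument \<open>1 - \<beta> t\<close> is \<open>1\<close>, where essential positivity says nothing.\<close>
    proof (cases "\<beta> t = 0")
      case True
      then show ?thesis by (simp add: q_def)
    next
      case False
      let ?s = "1 - \<beta> t"
      have s: "a \<le> ?s" "?s < 1"
        using t beta_range[OF t(1)] False by (auto simp: a_def)
      have "\<alpha> t * \<beta> t \<le> (1 + \<gamma> ?s) * \<beta> t"
        using alpha_le[OF t(1)] beta_range[OF t(1)] by (intro mult_right_mono) auto
      also have "\<dots> = 1 - (?s - (1 - ?s) * \<gamma> ?s)"
        by (simp add: algebra_simps)
      also have "\<dots> \<le> q" using c(2)[OF s] by (simp add: q_def)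
      finally show ?thesis .
    qed
  qed
qed

lemma product_less_one:
  fixes \<alpha> \<beta> \<gamma> :: "real \<Rightarrow> real"
  assumes "\<And>t. t \<ge> 0 \<Longrightarrow> 0 \<le> \<beta> t \<and> \<beta> t < 1"
    and "\<And>t. t \<ge> 0 \<Longrightarrow> \<alpha> t \<le> 1 + \<gamma> (1 - \<beta> t)"
    and "essentially_positive (\<lambda>s. s - (1 - s) * \<gamma> s)"
    and t: "t \<ge> 0"
  shows "\<alpha> t * \<beta> t < 1"
proof -
  have "\<beta> t < 1" using assms(1) t by blast
  then obtain q where "q < 1" "\<And>u. u \<ge> 0 \<Longrightarrow> \<beta> u \<le> \<beta> t \<Longrightarrow> \<alpha> u * \<beta> u \<le> q"
    using product_bounded_away_from_one[where \<alpha> = \<alpha> and \<beta> = \<beta> and \<gamma> = \<gamma>, OF assms(1-3)]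
    by metis
  with t show ?thesis by (meson le_less_trans order_refl)
qed

text \<open>Stable positivity takes the place of lower semicontinuity: around a point where \<open>h\<close> is
  positive, \<open>h\<close> stays above a positive constant, so a sequence along which \<open>h\<close> tends to \<open>0\<close>
  cannot converge to such a point.\<close>

lemma stably_positive_zero_at_limit:
  assumes "stably_positive h" "x \<longlonglongrightarrow> l" "(\<lambda>n. h (x n)) \<longlonglongrightarrow> 0"
  shows "h l = 0"
proof (rule ccontr)
  assume "h l \<noteq> 0"
  have nonneg: "\<And>y. h y \<ge> 0" using assms(1) by (simp add: stably_positive_def)
  with \<open>h l \<noteq> 0\<close> have "h l > 0" by (simp add: order_less_le)
  then obtain U where U: "open U" "l \<in> U" "(INF y\<in>U. h y) > 0"
    using assms(1) unfolding stably_positive_def by blast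
  have "eventually (\<lambda>n. x n \<in> U) sequentially"
    using assms(2) U(1,2) by (rule topological_tendstoD)
  moreover have "eventually (\<lambda>n. h (x n) < (INF y\<in>U. h y)) sequentially"
    using assms(3) U(3) by (rule order_tendstoD)
  ultimately have "eventually (\<lambda>n. x n \<in> U \<and> h (x n) < (INF y\<in>U. h y)) sequentially"
    by (rule eventually_conj)
  then obtain n where n: "x n \<in> U" "h (x n) < (INF y\<in>U. h y)"
    by (auto dest: eventually_happens)
  have "bdd_below (h ` U)" using nonneg by (intro bdd_belowI[of _ 0]) auto
  then have "(INF y\<in>U. h y) \<le> h (x n)" using n(1) by (rule cINF_lower)
  with n(2) show False by simp
qed

section \<open>Step lengths and gaps along an orbit\<close>

text \<open>From here on \<open>d n\<close> is the length of the step from the \<open>n\<close>-th point of an orbit and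
  \<open>f n\<close> is the distance (the gap) from this point to its image. The last hypothesis is
  the combination of (A) and (B).

  A positive limit \<open>L\<close> of the gaps is impossible: such gaps shrink by factors tending to
  \<open>1\<close>, which is compatible with essential positivity only if \<open>\<beta> (d n)\<close> tends to \<open>1\<close>.
  But then \<open>d n\<close> is squeezed to \<open>L\<close> from above, where (MT) keeps \<open>\<beta>\<close> below some
  \<open>b < 1\<close>.\<close>

lemma gap_tendsto_zero:
  fixes \<alpha> \<beta> \<gamma> :: "real \<Rightarrow> real" and d f :: "nat \<Rightarrow> real"
  assumes beta_range: "\<And>t. t \<ge> 0 \<Longrightarrow> 0 \<le> \<beta> t \<and> \<beta> t < 1"
    and beta_MT: "property_MT \<beta>"
    and alpha_le: "\<And>t. t \<ge> 0 \<Longrightarrow> \<alpha> t \<le> 1 + \<gamma> (1 - \<beta> t)"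
    and gamma_lim: "(\<gamma> \<longlongrightarrow> 0) (at_right 0)"
    and p_ess_pos: "essentially_positive (\<lambda>s. s - (1 - s) * \<gamma> s)"
    and d_pos: "\<And>n. d n > 0"
    and f_pos: "\<And>n. f n > 0"
    and f_le: "\<And>n. f n \<le> d n"
    and A: "\<And>n. d n \<le> \<alpha> (d n) * f n"
    and AB: "\<And>n. f (Suc n) \<le> \<alpha> (d n) * \<beta> (d n) * f n"
  shows "f \<longlonglongrightarrow> 0"
proof -
  have d_nonneg: "d n \<ge> 0" for n using d_pos[of n] by simp
  have f_less: "f (Suc n) < f n" for n
  proof -
    have "\<alpha> (d n) * \<beta> (d n) * f n < 1 * f n"
      by (intro mult_strict_right_mono f_pos
            product_less_one[where \<alpha> = \<alpha> and \<beta> = \<beta> and \<gamma> = \<gamma>,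
            OF beta_range alpha_le p_ess_pos d_nonneg])
    with AB[of n] show ?thesis by simp
  qed
  have "decseq f" using f_less by (auto intro: decseq_SucI less_imp_le)
  then obtain L where L: "f \<longlonglongrightarrow> L" "\<And>n. L \<le> f n"
    using decseq_convergent[of f 0] f_pos less_imp_le by metis
  have L_less: "L < f n" for n using L(2)[of "Suc n"] f_less[of n] by simp
  have "L \<ge> 0" using L(1) f_pos by (intro LIMSEQ_le_const) (auto intro: less_imp_le)
  show ?thesis
  proof (cases "L = 0")
    case True
    with L(1) show ?thesis by simp
  next
    case False
    with \<open>L \<ge> 0\<close> have "L > 0" by simp
    have "(\<lambda>n. f (Suc n) / f n) \<longlonglongrightarrow> L / L"
      using L(1) False by (intro tendsto_divide LIMSEQ_Suc) auto
    then have ratio: "(\<lambda>n. f (Suc n) / f n) \<longlonglongrightarrow> 1" using False by simp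
    have beta_ev: "eventually (\<lambda>n. b < \<beta> (d n)) sequentially" if b: "b < 1" for b
    proof -
      obtain q where q: "q < 1" "\<And>t. t \<ge> 0 \<Longrightarrow> \<beta> t \<le> b \<Longrightarrow> \<alpha> t * \<beta> t \<le> q"
        using product_bounded_away_from_one[where \<alpha> = \<alpha> and \<beta> = \<beta> and \<gamma> = \<gamma>,
            OF beta_range alpha_le p_ess_pos b] by metis
      have "eventually (\<lambda>n. q < f (Suc n) / f n) sequentially"
        using ratio q(1) by (rule order_tendstoD)
      then show ?thesis
      proof (rule eventually_mono)
        fix n assume "q < f (Suc n) / f n"
        also have "\<dots> \<le> \<alpha> (d n) * \<beta> (d n)"
          using AB[of n] f_pos[of n] by (simp add: pos_divide_le_eq)
        finally show "b < \<beta> (d n)" using q(2)[OF d_nonneg[of n]] by force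
      qed
    qed
    have beta_lim: "(\<lambda>n. \<beta> (d n)) \<longlonglongrightarrow> 1"
    proof (rule order_tendstoI)
      show "eventually (\<lambda>n. \<beta> (d n) < a) sequentially" if "1 < a" for a
        using beta_range[OF d_nonneg] that by (auto intro!: always_eventually intro: less_trans)
    qed (rule beta_ev)
    have s_lim: "filterlim (\<lambda>n. 1 - \<beta> (d n)) (at_right 0) sequentially"
      unfolding filterlim_at
    proof
      show "\<forall>\<^sub>F n in sequentially. 1 - \<beta> (d n) \<in> {0<..} \<and> 1 - \<beta> (d n) \<noteq> 0"
        using beta_range[OF d_nonneg] by (auto intro!: always_eventually simp: less_le)
      show "(\<lambda>n. 1 - \<beta> (d n)) \<longlonglongrightarrow> 0"
        using tendsto_diff[OF tendsto_const[of 1] beta_lim] by simp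
    qed
    have "(\<lambda>n. (1 + \<gamma> (1 - \<beta> (d n))) * f n) \<longlonglongrightarrow> (1 + 0) * L"
      by (intro tendsto_intros L(1) filterlim_compose[OF gamma_lim s_lim])
    then have upper: "(\<lambda>n. (1 + \<gamma> (1 - \<beta> (d n))) * f n) \<longlonglongrightarrow> L" by simp
    have "d n \<le> (1 + \<gamma> (1 - \<beta> (d n))) * f n" for n
      using A[of n]
      by (rule order_trans) (intro mult_right_mono alpha_le d_nonneg less_imp_le[OF f_pos])
    then have d_lim: "d \<longlonglongrightarrow> L"
      using tendsto_sandwich[OF _ _ L(1) upper] f_le by (simp add: always_eventually)
    \<comment> \<open>The gaps lie strictly above their limit, so the steps approach \<open>L\<close> from the right.\<close>
    have "L < d n" for n using L_less[of n] f_le[of n] by simp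
    then have d_right: "filterlim d (at_right L) sequentially"
      unfolding filterlim_at using d_lim by (auto intro!: always_eventually simp: less_le)
    obtain b where b: "b < 1" "eventually (\<lambda>s. \<beta> s < b) (at_right L)"
      using property_MT_bound[OF beta_MT \<open>L \<ge> 0\<close>] by blast
    have "eventually (\<lambda>n. \<beta> (d n) < b) sequentially"
      using b(2) d_right by (rule eventually_compose_filterlim)
    then have "eventually (\<lambda>n. \<beta> (d n) < b \<and> b < \<beta> (d n)) sequentially"
      using beta_ev[OF b(1)] by (rule eventually_conj)
    then have False by (auto dest: eventually_happens)
    then show ?thesis ..
  qed
qed

text \<open>Once the steps are short, (MT) at \<open>0\<close> bounds \<open>\<beta> (d n)\<close> away from \<open>1\<close>; the gaps then
  decrease geometrically, and the steps are at most a constant times the gaps.\<close>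

lemma steps_summable:
  fixes \<alpha> \<beta> \<gamma> :: "real \<Rightarrow> real" and d f :: "nat \<Rightarrow> real"
  assumes beta_range: "\<And>t. t \<ge> 0 \<Longrightarrow> 0 \<le> \<beta> t \<and> \<beta> t < 1"
    and beta_MT: "property_MT \<beta>"
    and alpha_le: "\<And>t. t \<ge> 0 \<Longrightarrow> \<alpha> t \<le> 1 + \<gamma> (1 - \<beta> t)"
    and gamma_bounded: "bounded (\<gamma> ` {0<..1})"
    and p_ess_pos: "essentially_positive (\<lambda>s. s - (1 - s) * \<gamma> s)"
    and d_pos: "\<And>n. d n > 0"
    and f_pos: "\<And>n. f n > 0"
    and A: "\<And>n. d n \<le> \<alpha> (d n) * f n"
    and AB: "\<And>n. f (Suc n) \<le> \<alpha> (d n) * \<beta> (d n) * f n"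
    and f_lim: "f \<longlonglongrightarrow> 0"
  shows "summable d"
proof -
  have d_nonneg: "d n \<ge> 0" for n using d_pos[of n] by simp
  obtain M where M: "\<And>s. s \<in> {0<..1} \<Longrightarrow> norm (\<gamma> s) \<le> M"
    using gamma_bounded unfolding bounded_iff by blast
  have d_le: "d n \<le> (1 + M) * f n" for n
  proof -
    have "\<gamma> (1 - \<beta> (d n)) \<le> M"
      using M[of "1 - \<beta> (d n)"] beta_range[OF d_nonneg[of n]] by auto
    then have "\<alpha> (d n) \<le> 1 + M" using alpha_le[OF d_nonneg[of n]] by simp
    then have "\<alpha> (d n) * f n \<le> (1 + M) * f n"
      using f_pos[of n] by (intro mult_right_mono) auto
    with A[of n] show ?thesis by simp
  qed
  have "(\<lambda>n. (1 + M) * f n) \<longlonglongrightarrow> 0"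
    using tendsto_mult_left[OF f_lim, of "1 + M"] by simp
  then have d_lim: "d \<longlonglongrightarrow> 0"
    by (rule tendsto_sandwich[OF _ _ tendsto_const[of 0], rotated 2])
      (simp_all add: d_nonneg d_le)
  then have d_right: "filterlim d (at_right 0) sequentially"
    unfolding filterlim_at using d_pos by (auto intro!: always_eventually simp: less_le)
  obtain b where b: "b < 1" "eventually (\<lambda>s. \<beta> s < b) (at_right 0)"
    using property_MT_bound[OF beta_MT, of 0] by auto
  obtain q where q: "q < 1" "\<And>t. t \<ge> 0 \<Longrightarrow> \<beta> t \<le> b \<Longrightarrow> \<alpha> t * \<beta> t \<le> q"
    using product_bounded_away_from_one[where \<alpha> = \<alpha> and \<beta> = \<beta> and \<gamma> = \<gamma>,
            OF beta_range alpha_le p_ess_pos b(1)] by metis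
  have "eventually (\<lambda>n. \<beta> (d n) < b) sequentially"
    using b(2) d_right by (rule eventually_compose_filterlim)
  then obtain N where N: "\<And>n. n \<ge> N \<Longrightarrow> \<beta> (d n) < b"
    unfolding eventually_sequentially by blast
  have f_step: "norm (f (Suc n)) \<le> q * norm (f n)" if "n \<ge> N" for n
  proof -
    have "\<alpha> (d n) * \<beta> (d n) * f n \<le> q * f n"
      using q(2)[OF d_nonneg[of n]] N[OF that] f_pos[of n]
      by (intro mult_right_mono) auto
    with AB[of n] have "f (Suc n) \<le> q * f n" by (rule order_trans)
    then show ?thesis using f_pos[of n] f_pos[of "Suc n"] by simp
  qed
  have "summable f" using q(1) f_step by (rule summable_ratio_test)
  then have "summable (\<lambda>n. (1 + M) * f n)" by (rule summable_mult)
  then show ?thesis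
    by (rule summable_comparison_test') (simp add: d_le d_nonneg)
qed

section \<open>Sequences with summable steps\<close>

lemma dist_le_sum_of_steps:
  fixes x :: "nat \<Rightarrow> 'a::metric_space"
  assumes "m \<le> n"
  shows "dist (x m) (x n) \<le> (\<Sum>k=m..<n. dist (x k) (x (Suc k)))"
  using assms
proof (induction rule: dec_induct)
  case (step n)
  then show ?case using dist_triangle[of "x m" "x (Suc n)" "x n"] by simp
qed simp

lemma Cauchy_if_summable_steps:
  fixes x :: "nat \<Rightarrow> 'a::metric_space"
  assumes "summable (\<lambda>n. dist (x n) (x (Suc n)))"
  shows "Cauchy x"
  unfolding Cauchy_altdef
proof (intro allI impI)
  fix e :: real assume "e > 0"
  then obtain N where N: "\<And>m n. m \<ge> N \<Longrightarrow> norm (\<Sum>k=m..<n. dist (x k) (x (Suc k))) < e"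
    using assms unfolding summable_Cauchy by blast
  have "dist (x m) (x n) < e" if "m \<ge> N" "n > m" for m n
    using dist_le_sum_of_steps[of m n x] N[OF that(1), of n] that(2) by simp
  then show "\<exists>M. \<forall>m\<ge>M. \<forall>n>m. dist (x m) (x n) < e" by blast
qed

section \<open>The fixed point theorem\<close>

theorem theorem1p4:
  fixes \<alpha> \<beta> \<gamma> :: "real \<Rightarrow> real"
    and F :: "'a::complete_space \<Rightarrow> 'a set"
  assumes alpha_range: "\<And>t. t \<ge> 0 \<Longrightarrow> \<alpha> t \<ge> 1"
    and beta_range: "\<And>t. t \<ge> 0 \<Longrightarrow> 0 \<le> \<beta> t \<and> \<beta> t < 1"
    and beta_MT: "property_MT \<beta>"
    and gamma_range: "\<And>s. s \<in> {0<..1} \<Longrightarrow> \<gamma> s \<ge> 0"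
    and alpha_le: "\<And>t. t \<ge> 0 \<Longrightarrow> \<alpha> t \<le> 1 + \<gamma> (1 - \<beta> t)"
    and gamma_bounded: "bounded (\<gamma> ` {0<..1})"
    and gamma_lim: "(\<gamma> \<longlongrightarrow> 0) (at_right 0)"
    and p_ess_pos: "essentially_positive (\<lambda>s. s - (1 - s) * \<gamma> s)"
    and F_mapping: "alpha_beta_mapping \<alpha> \<beta> F"
    and dF_stable: "stably_positive (distance_function F)"
  shows "alpha_beta_contraction \<alpha> \<beta> F \<and> (\<exists>x. x \<in> F x)"
proof
  have "\<forall>t>0. \<alpha> t * \<beta> t < 1"
    by (auto intro: product_less_one[where \<alpha> = \<alpha> and \<beta> = \<beta> and \<gamma> = \<gamma>,
            OF beta_range alpha_le p_ess_pos])
  with F_mapping show "alpha_beta_contraction \<alpha> \<beta> F"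
    by (simp add: alpha_beta_contraction_def)
next
  let ?D = "distance_function F"
  obtain g where g: "\<And>x. g x \<in> F x"
      "\<And>x. dist x (g x) \<le> \<alpha> (dist x (g x)) * ?D x"
      "\<And>x. ?D (g x) \<le> \<beta> (dist x (g x)) * dist x (g x)"
    using F_mapping unfolding alpha_beta_mapping_def by metis
  have F_closed: "closed (F x)" "F x \<noteq> {}" for x
    using F_mapping by (auto simp: alpha_beta_mapping_def closed_valued_def)
  define x where "x n = (g ^^ n) undefined" for n
  have x_Suc: "x (Suc n) = g (x n)" for n by (simp add: x_def)
  define d where "d n = dist (x n) (x (Suc n))" for n
  define f where "f n = ?D (x n)" for n
  show "\<exists>x. x \<in> F x"
  proof (cases "\<exists>n. d n = 0")
    case True
    then show ?thesis using g(1) by (metis d_def dist_eq_0_iff x_Suc)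
  next
    case False
    then have d_pos: "d n > 0" for n by (simp add: d_def)
    have A: "d n \<le> \<alpha> (d n) * f n" and B: "f (Suc n) \<le> \<beta> (d n) * d n" for n
      using g(2,3)[of "x n"] by (simp_all add: d_def f_def x_Suc)
    have f_le: "f n \<le> d n" for n
      using infdist_le[OF g(1), of "x n" "x n"]
      by (simp add: f_def d_def distance_function_def x_Suc)
    have f_pos: "f n > 0" for n
    proof -
      have "0 < \<alpha> (d n) * f n" using A[of n] d_pos[of n] by simp
      then show ?thesis
        using alpha_range[of "d n"] d_pos[of n] by (simp add: zero_less_mult_iff)
    qed
    have AB: "f (Suc n) \<le> \<alpha> (d n) * \<beta> (d n) * f n" for n
    proof -
      have "\<beta> (d n) * d n \<le> \<beta> (d n) * (\<alpha> (d n) * f n)"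
        using A[of n] beta_range[of "d n"] d_pos[of n] by (intro mult_left_mono) auto
      with B[of n] show ?thesis by (simp add: mult_ac)
    qed
    have f_lim: "f \<longlonglongrightarrow> 0"
      by (rule gap_tendsto_zero[where \<alpha> = \<alpha> and \<beta> = \<beta> and \<gamma> = \<gamma> and d = d and f = f,
            OF beta_range beta_MT alpha_le gamma_lim p_ess_pos
            d_pos f_pos f_le A AB])
    have "summable d"
      by (rule steps_summable[where \<alpha> = \<alpha> and \<beta> = \<beta> and \<gamma> = \<gamma> and d = d and f = f,
            OF beta_range beta_MT alpha_le gamma_bounded p_ess_pos
            d_pos f_pos A AB f_lim])
    then have "Cauchy x"
      unfolding d_def by (rule Cauchy_if_summable_steps)
    then obtain l where l: "x \<longlonglongrightarrow> l"
      using Cauchy_convergent convergentD by blast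
    have "?D l = 0"
      using f_lim unfolding f_def by (rule stably_positive_zero_at_limit[OF dF_stable l])
    then have "l \<in> F l"
      using in_closed_iff_infdist_zero[OF F_closed] by (simp add: distance_function_def)
    then show ?thesis ..
  qed
qed

end
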